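(* Let $n,p,q,s$ be positive integers. Then $\mathbf{A}:=(\mathbb{R}^{n\times q\times s},+)$ is an abelian group, $\mathbf{R}:=(\mathbb{R}^{n\times p\times s},+,\ltimes_* )$ is a ring, and, with the map $\pi:\mathbf{R}\times\mathbf{A}\to\mathbf{A}$ defined by $\pi(A,X):=A\ltimes_*X$ for $A\in\mathbf{R}$, $X\in\mathbf{A}$, $\mathbf{A}$ is a left $\mathbf{R}$-module.
   Context: A cubic matrix $A=(a_{i,j,k})\in\mathbb{R}^{m\times n\times s}$ has frontal slices $A^{(k)}=(a_{i,j,k})_{i,j}\in\mathbb{R}^{m\times n}$, $k\in[1,s]$, and is identified with the $sm\times n$ block-column matrix with blocks $A^{(1)},\dots,A^{(s)}$. Addition is entrywise. $\Gamma(A)=\mathrm{bcirc}(A)\in\mathbb{R}^{sm\times sn}$ is the block circulant matrix whose $(a,b)$ block ($a,b\in[1,s]$) is $A^{(c)}$ with $c\in[1,s]$, $c\equiv a-b+1 \pmod s$. DK-STP of matrices: for $M\in\mathbb{R}^{m\times n}$, $N\in\mathbb{R}^{p\times q}$ and $t=\mathrm{lcm}(n,p)$, $M\ltimes_{DK} N:=(M\otimes \mathbf{1}_{t/n}^T)(N\otimes\mathbf{1}_{t/p})\in\mathbb{R}^{m\times q}$, where $\mathbf{1}_k$ is the all-ones column vector of length $k$. t-STP: for $A\in\mathbb{R}^{m\times n\times s}$, $B\in\mathbb{R}^{p\times q\times s}$, $A\ltimes_* B:=\Gamma(A)\ltimes_{DK}B$, where $B$ is taken as its $sp\times q$ block column,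 and the resulting $sm\times q$ matrix is identified with an element of $\mathbb{R}^{m\times q\times s}$. Rings are not required to have an identity. Left module means: $r(a+b)=ra+rb$, $(r_1+r_2)a=r_1a+r_2a$, $r_1(r_2a)=(r_1r_2)a$. *)

theory Defs
  imports "Jordan_Normal_Form.Matrix" "HOL-Library.FuncSet"
begin

section \<open>Rings without identity and their left modules\<close>

text \<open>
  The locales \<open>ring\<close> and \<open>module\<close> of HOL-Algebra require a ring with identity
  (and, for \<open>module\<close>, a commutative one), so their counterparts without identity are
  introduced here. The record field \<open>one\<close> of the ring, and the fields \<open>one\<close> and
  \<open>mult\<close> of the module, play no role.
\<close>

locale nonunital_ring = abelian_group R for R (structure) +
  assumes m_closed:
      "\<lbrakk>x \<in> carrier R; y \<in> carrier R\<rbrakk> \<Longrightarrow> x \<otimes> y \<in> carrier R"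
    and m_assoc:
      "\<lbrakk>x \<in> carrier R; y \<in> carrier R; z \<in> carrier R\<rbrakk> \<Longrightarrow>
        (x \<otimes> y) \<otimes> z = x \<otimes> (y \<otimes> z)"
    and l_distr:
      "\<lbrakk>x \<in> carrier R; y \<in> carrier R; z \<in> carrier R\<rbrakk> \<Longrightarrow>
        (x \<oplus> y) \<otimes> z = x \<otimes> z \<oplus> y \<otimes> z"
    and r_distr:
      "\<lbrakk>x \<in> carrier R; y \<in> carrier R; z \<in> carrier R\<rbrakk> \<Longrightarrow>
        z \<otimes> (x \<oplus> y) = z \<otimes> x \<oplus> z \<otimes> y"

locale left_module = R?: nonunital_ring R + M?: abelian_group M
  for R (structure) and M (structure) +
  assumes smult_closed:
      "\<lbrakk>a \<in> carrier R; x \<in> carrier M\<rbrakk> \<Longrightarrow> a \<odot>\<^bsub>M\<^esub> x \<in> carrier M"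
    and smult_r_distr:
      "\<lbrakk>a \<in> carrier R; x \<in> carrier M; y \<in> carrier M\<rbrakk> \<Longrightarrow>
        a \<odot>\<^bsub>M\<^esub> (x \<oplus>\<^bsub>M\<^esub> y) = a \<odot>\<^bsub>M\<^esub> x \<oplus>\<^bsub>M\<^esub> a \<odot>\<^bsub>M\<^esub> y"
    and smult_l_distr:
      "\<lbrakk>a \<in> carrier R; b \<in> carrier R; x \<in> carrier M\<rbrakk> \<Longrightarrow>
        (a \<oplus>\<^bsub>R\<^esub> b) \<odot>\<^bsub>M\<^esub> x = a \<odot>\<^bsub>M\<^esub> x \<oplus>\<^bsub>M\<^esub> b \<odot>\<^bsub>M\<^esub> x"
    and smult_assoc:
      "\<lbrakk>a \<in> carrier R; b \<in> carrier R; x \<in> carrier M\<rbrakk> \<Longrightarrow>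
        a \<odot>\<^bsub>M\<^esub> (b \<odot>\<^bsub>M\<^esub> x) = (a \<otimes>\<^bsub>R\<^esub> b) \<odot>\<^bsub>M\<^esub> x"


section \<open>The DK-STP of matrices\<close>

definition kronecker :: "real mat \<Rightarrow> real mat \<Rightarrow> real mat" where
  "kronecker A B =
    mat (dim_row A * dim_row B) (dim_col A * dim_col B)
      (\<lambda>(i, j). A $$ (i div dim_row B, j div dim_col B) *
                B $$ (i mod dim_row B, j mod dim_col B))"

definition ones_col :: "nat \<Rightarrow> real mat" where
  "ones_col k = mat k 1 (\<lambda>_. 1)"

definition dk_stp :: "real mat \<Rightarrow> real mat \<Rightarrow> real mat" where
  "dk_stp M N =
    (let n = dim_col M; p = dim_row N; t = lcm n p
     in kronecker M (transpose_mat (ones_col (t div n))) * kronecker N (ones_col (t div p)))"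


section \<open>Cubic matrices and the t-STP\<close>

text \<open>
  All indices are zero-based. A cubic matrix of size \<open>m \<times> n \<times> s\<close> is a function on index
  triples \<open>(i, j, k)\<close>, extensional on the index set so that equality is entrywise equality.
\<close>

type_synonym cubic = "nat \<times> nat \<times> nat \<Rightarrow> real"

definition cubic_index :: "nat \<Rightarrow> nat \<Rightarrow> nat \<Rightarrow> (nat \<times> nat \<times> nat) set" where
  "cubic_index m n s = {..<m} \<times> {..<n} \<times> {..<s}"

definition cubic_carrier :: "nat \<Rightarrow> nat \<Rightarrow> nat \<Rightarrow> cubic set" where
  "cubic_carrier m n s = cubic_index m n s \<rightarrow>\<^sub>E UNIV"

definition cubic_add :: "nat \<Rightarrow> nat \<Rightarrow> nat \<Rightarrow> cubic \<Rightarrow> cubic \<Rightarrow> cubic" where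
  "cubic_add m n s A B = restrict (\<lambda>x. A x + B x) (cubic_index m n s)"

definition cubic_zero :: "nat \<Rightarrow> nat \<Rightarrow> nat \<Rightarrow> cubic" where
  "cubic_zero m n s = restrict (\<lambda>_. 0) (cubic_index m n s)"

definition frontal_slice :: "nat \<Rightarrow> nat \<Rightarrow> cubic \<Rightarrow> nat \<Rightarrow> real mat" where
  "frontal_slice m n A k = mat m n (\<lambda>(i, j). A (i, j, k))"

text \<open>
  The identification of a cubic matrix with the column of its frontal slices, and its inverse:
  row \<open>k * m + i\<close> of the block column is row \<open>i\<close> of slice \<open>k\<close>.
\<close>

definition to_block_col :: "nat \<Rightarrow> nat \<Rightarrow> nat \<Rightarrow> cubic \<Rightarrow> real mat" where
  "to_block_col m n s A =
    mat (s * m) n (\<lambda>(i, j). frontal_slice m n A (i div m) $$ (i mod m, j))"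

definition of_block_col :: "nat \<Rightarrow> nat \<Rightarrow> nat \<Rightarrow> real mat \<Rightarrow> cubic" where
  "of_block_col m n s M = restrict (\<lambda>(i, j, k). M $$ (k * m + i, j)) (cubic_index m n s)"

text \<open>
  With zero-based block indices \<open>a\<close>, \<open>b\<close> and slice index \<open>c\<close>, the one-based condition
  \<open>c \<equiv> a - b + 1 (mod s)\<close> becomes \<open>c \<equiv> a - b (mod s)\<close>; the subtraction must be
  done on integers.
\<close>

definition bcirc :: "nat \<Rightarrow> nat \<Rightarrow> nat \<Rightarrow> cubic \<Rightarrow> real mat" where
  "bcirc m n s A =
    mat (s * m) (s * n)
      (\<lambda>(i, j). frontal_slice m n A (nat ((int (i div m) - int (j div n)) mod int s))
                  $$ (i mod m, j mod n))"

text \<open>The product of an \<open>m \<times> n \<times> s\<close> and a \<open>p \<times> q \<times> s\<close> cubic matrix.\<close>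

definition t_stp ::
  "nat \<Rightarrow> nat \<Rightarrow> nat \<Rightarrow> nat \<Rightarrow> nat \<Rightarrow> cubic \<Rightarrow> cubic \<Rightarrow> cubic" where
  "t_stp m n p q s A B =
    of_block_col m q s (dk_stp (bcirc m n s A) (to_block_col p q s B))"


section \<open>The algebraic structures\<close>

definition cubic_group :: "nat \<Rightarrow> nat \<Rightarrow> nat \<Rightarrow> cubic ring" where
  "cubic_group m n s =
    \<lparr>carrier = cubic_carrier m n s, mult = undefined, one = undefined,
     zero = cubic_zero m n s, add = cubic_add m n s\<rparr>"

definition t_stp_ring :: "nat \<Rightarrow> nat \<Rightarrow> nat \<Rightarrow> cubic ring" where
  "t_stp_ring n p s = (cubic_group n p s)\<lparr>mult := t_stp n p n p s\<rparr>"

text \<open>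
  The group of \<open>n \<times> q \<times> s\<close> cubic matrices, with the \<open>n \<times> p \<times> s\<close> ones acting from the left.
\<close>

definition t_stp_module :: "nat \<Rightarrow> nat \<Rightarrow> nat \<Rightarrow> nat \<Rightarrow> (cubic, cubic) module" where
  "t_stp_module n p q s = ring.extend (cubic_group n q s) (module.fields (t_stp n p n q s))"

end

theory Submission
  imports Defs
begin

text \<open>
  The all-ones vectors in the DK-STP only reindex the summation. As the inner dimensions of
  \<open>bcirc A\<close> and of the block column of \<open>B\<close> share the factor \<open>s\<close>, this reindexing respects the
  blocks, so slice \<open>k\<close> of the t-STP is the cyclic convolution
  \<open>\<Sum>c<s. A\<^bsup>(k - c)\<^esup> \<ltimes>\<^bsub>DK\<^esub> B\<^bsup>(c)\<^esup>\<close>. This expression is bilinear, and its associativity follows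
  from exchanging sums and shifting the summation index modulo \<open>s\<close>.
\<close>

section \<open>Differences of slice indices modulo \<open>s\<close>\<close>

text \<open>The index of the slice that \<open>bcirc\<close> places in block
  \<open>(a, b)\<close>.\<close>

definition cyclic_diff :: "nat \<Rightarrow> nat \<Rightarrow> nat \<Rightarrow> nat" where
  "cyclic_diff s a b = nat ((int a - int b) mod int s)"

lemma cyclic_diff_less: "s > 0 \<Longrightarrow> cyclic_diff s a b < s"
  by (simp add: cyclic_diff_def nat_less_iff)

lemma int_cyclic_diff: "s > 0 \<Longrightarrow> int (cyclic_diff s a b) = (int a - int b) mod int s"
  by (simp add: cyclic_diff_def)

text \<open>A common shift cancels modulo \<open>s\<close>; associativity uses this for the slice
  index of the leftmost factor.\<close>

lemma cyclic_diff_diff: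
  assumes "s > 0"
  shows "cyclic_diff s (cyclic_diff s a c) (cyclic_diff s b c) = cyclic_diff s a b"
proof -
  have "(int (cyclic_diff s a c) - int (cyclic_diff s b c)) mod int s = (int a - int b) mod int s"
    by (simp add: int_cyclic_diff[OF assms] mod_diff_eq)
  then show ?thesis
    unfolding cyclic_diff_def[of s "cyclic_diff s a c"] by (simp add: cyclic_diff_def)
qed

text \<open>Subtracting a fixed \<open>c\<close> permutes the residues modulo \<open>s\<close>;
  adding \<open>c\<close> inverts it.\<close>

lemma sum_cyclic_diff:
  fixes f :: "nat \<Rightarrow> 'a::comm_monoid_add"
  assumes "s > 0"
  shows "(\<Sum>d<s. f d) = (\<Sum>e<s. f (cyclic_diff s e c))"
proof (rule sum.reindex_bij_witness[where i = "\<lambda>e. cyclic_diff s e c" and j = "\<lambda>d. (d + c) mod s"])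
  fix d assume "d \<in> {..<s}"
  then show "cyclic_diff s ((d + c) mod s) c = d"
    by (simp add: cyclic_diff_def of_nat_mod mod_diff_left_eq)
  then show "f (cyclic_diff s ((d + c) mod s) c) = f d" by simp
  show "(d + c) mod s \<in> {..<s}" using assms by simp
next
  fix e assume e: "e \<in> {..<s}"
  have "int ((cyclic_diff s e c + c) mod s) = int e"
    using e by (simp add: int_cyclic_diff[OF assms] of_nat_mod mod_add_left_eq)
  then show "(cyclic_diff s e c + c) mod s = e" by linarith
  show "cyclic_diff s e c \<in> {..<s}" using assms by (simp add: cyclic_diff_less)
qed

section \<open>Entries of the DK-STP and of the t-STP\<close>

lemma sum_lessThan_mult:
  fixes f :: "nat \<Rightarrow> 'a::comm_monoid_add"
  shows "(\<Sum>x<s * L. f x) = (\<Sum>c<s. \<Sum>l<L. f (c * L + l))"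
proof -
  have "(\<Sum>x<s * L. f x) = (\<Sum>c<s. sum f {c * L..<c * L + L})"
    by (rule sum.nat_group[symmetric])
  also have "\<dots> = (\<Sum>c<s. \<Sum>l<L. f (c * L + l))"
  proof (rule sum.cong[OF refl])
    fix c
    show "sum f {c * L..<c * L + L} = (\<Sum>l<L. f (c * L + l))"
      using sum.shift_bounds_nat_ivl[of f 0 "c * L" L]
      by (simp add: lessThan_atLeast0 add.commute)
  qed
  finally show ?thesis .
qed

text \<open>The Kronecker product with an all-ones row repeats each column of \<open>M\<close>, and
  that with an all-ones column repeats each row of \<open>N\<close>. Position \<open>x\<close> of
  the expanded index therefore reads the original at a quotient.\<close>

lemma dk_stp_entry:
  assumes "i < dim_row M" "j < dim_col N" "dim_col M > 0" "dim_row N > 0"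
  defines "t \<equiv> lcm (dim_col M) (dim_row N)"
  shows "dk_stp M N $$ (i, j) =
    (\<Sum>x<t. M $$ (i, x div (t div dim_col M)) * N $$ (x div (t div dim_row N), j))"
proof -
  have t: "dim_col M * (t div dim_col M) = t" "dim_row N * (t div dim_row N) = t"
    by (simp_all add: t_def)
  \<comment> \<open>An index below \<open>t\<close> forces \<open>t\<close>, hence both repetition
    factors, to be positive, so the remainders are valid positions in the all-ones vectors.\<close>
  have [simp]: "x mod (t div dim_col M) < t div dim_col M"
    "x mod (t div dim_row N) < t div dim_row N" if "x < t" for x
    using that t by (metis mod_less_divisor mult_0_right not_gr_zero not_less_zero)+
  show ?thesis
    using assms(1,2) t
    by (auto simp: dk_stp_def Let_def kronecker_def ones_col_def scalar_prod_def t_def[symmetric]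
        lessThan_atLeast0 intro!: sum.cong)
qed

text \<open>Since \<open>u\<close> divides the block length \<open>L\<close>, a run of
  \<open>u\<close> repeated entries never crosses a block boundary, and the quotient by
  \<open>u\<close> stays in block \<open>c\<close>.\<close>

lemma block_index:
  fixes c l L n u :: nat
  assumes "L = n * u" "l < L"
  shows "(c * L + l) div u div n = c" "(c * L + l) div u mod n = l div u"
    "(c * L + l) div u = c * n + l div u" "l div u < n"
proof -
  have u: "u > 0" using assms by (cases u) auto
  show l: "l div u < n" using assms by (simp add: less_mult_imp_div_less)
  have "c * L + l = l + (c * n) * u" using assms by simp
  then show *: "(c * L + l) div u = c * n + l div u" using u by (simp only: div_mult_self1)
  show "(c * L + l) div u div n = c" "(c * L + l) div u mod n = l div u"
    using l by (simp_all add: *)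
qed

lemma block_index_less:
  fixes c l :: nat
  assumes "c < s" "l < n"
  shows "c * n + l < s * n"
proof -
  have "c * n + l < Suc c * n" using assms by simp
  also have "\<dots> \<le> s * n" using assms by (intro mult_le_mono1) simp
  finally show ?thesis .
qed

lemma t_stp_entry:
  assumes pos: "n > 0" "p > 0" "s > 0"
    and idx: "(i, j, k) \<in> cubic_index m q s"
  shows "t_stp m n p q s A B (i, j, k) =
    (\<Sum>c<s. \<Sum>l<lcm n p. A (i, l div (lcm n p div n), cyclic_diff s k c) *
                             B (l div (lcm n p div p), j, c))"
proof -
  define L where "L = lcm n p"
  define u where "u = L div n"
  define v where "v = L div p"
  have L: "L = n * u" "L = p * v" by (simp_all add: L_def u_def v_def)
  have ijk: "i < m" "j < q" "k < s" using idx by (auto simp: cubic_index_def)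
  have ki: "k * m + i < s * m" using ijk by (simp add: block_index_less)
  \<comment> \<open>The common factor \<open>s\<close> comes out of the lcm, so the repetition
    factors \<open>u\<close> and \<open>v\<close> are those of a single pair of slices.\<close>
  have t: "lcm (s * n) (s * p) = s * L" by (simp add: L_def lcm_mult_left)
  have quot: "L div n = u" "L div p = v" by (simp_all add: u_def v_def)
  have "t_stp m n p q s A B (i, j, k) =
      dk_stp (bcirc m n s A) (to_block_col p q s B) $$ (k * m + i, j)"
    using idx by (simp add: t_stp_def of_block_col_def)
  also have "\<dots> = (\<Sum>x<s * L. bcirc m n s A $$ (k * m + i, x div u) *
      to_block_col p q s B $$ (x div v, j))"
    using dk_stp_entry[of "k * m + i" "bcirc m n s A" j "to_block_col p q s B"] pos ki ijk
    by (simp add: bcirc_def to_block_col_def t quot)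
  also have "\<dots> = (\<Sum>c<s. \<Sum>l<L. bcirc m n s A $$ (k * m + i, (c * L + l) div u) *
      to_block_col p q s B $$ ((c * L + l) div v, j))"
    by (rule sum_lessThan_mult)
  also have "\<dots> = (\<Sum>c<s. \<Sum>l<L. A (i, l div u, cyclic_diff s k c) * B (l div v, j, c))"
  proof (intro sum.cong refl arg_cong2[where f = "(*)"])
    fix c l assume cl: "c \<in> {..<s}" "l \<in> {..<L}"
    then have lL: "l < L" and cs: "c < s" by auto
    note bu = block_index[OF L(1) lL] and bv = block_index[OF L(2) lL]
    have "(c * L + l) div u < s * n" "(c * L + l) div v < s * p"
      using bu(3,4) bv(3,4) cs by (simp_all add: block_index_less)
    then show "bcirc m n s A $$ (k * m + i, (c * L + l) div u) = A (i, l div u, cyclic_diff s k c)"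
      and "to_block_col p q s B $$ ((c * L + l) div v, j) = B (l div v, j, c)"
      using bu(1,2,4) bv(1,2,4) ki ijk cs
      by (simp_all add: bcirc_def to_block_col_def frontal_slice_def cyclic_diff_def)
  qed
  finally show ?thesis by (simp add: L_def u_def v_def)
qed

section \<open>Closure, additivity and associativity of the t-STP\<close>

lemma t_stp_closed: "t_stp m n p q s A B \<in> cubic_carrier m q s"
  by (simp add: t_stp_def of_block_col_def cubic_carrier_def)

lemma cubic_add_closed: "cubic_add m n s A B \<in> cubic_carrier m n s"
  by (simp add: cubic_add_def cubic_carrier_def)

lemma cubic_eqI:
  assumes "A \<in> cubic_carrier m n s" "B \<in> cubic_carrier m n s"
    and "\<And>i j k. (i, j, k) \<in> cubic_index m n s \<Longrightarrow> A (i, j, k) = B (i, j, k)"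
  shows "A = B"
  using assms unfolding cubic_carrier_def by (metis PiE_ext prod_cases3)

lemma cubic_add_entry:
  "x \<in> cubic_index m n s \<Longrightarrow> cubic_add m n s A B x = A x + B x"
  by (simp add: cubic_add_def)

lemma div_lcm_less:
  fixes n p l :: nat
  assumes "l < lcm n p"
  shows "l div (lcm n p div n) < n" "l div (lcm n p div p) < p"
  by (rule block_index(4)[OF _ assms]; simp)+

text \<open>Keeps the entries read by \<open>t_stp_entry\<close> in range, so that an entry formula
  for a sum or an inner product can be substituted for either factor.\<close>

lemma t_stp_index:
  fixes n p l :: nat
  assumes "(i, j, k) \<in> cubic_index m q s" "l < lcm n p" "c < s"
  shows "(i, l div (lcm n p div n), cyclic_diff s k c) \<in> cubic_index m n s"
    "(l div (lcm n p div p), j, c) \<in> cubic_index p q s"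
  using assms div_lcm_less[OF assms(2)] by (auto simp: cubic_index_def cyclic_diff_less)

lemma t_stp_add_left:
  assumes "n > 0" "p > 0" "s > 0"
  shows "t_stp m n p q s (cubic_add m n s A B) X =
    cubic_add m q s (t_stp m n p q s A X) (t_stp m n p q s B X)"
  by (rule cubic_eqI[OF t_stp_closed cubic_add_closed])
    (simp add: t_stp_entry[OF assms] cubic_add_entry t_stp_index distrib_right sum.distrib)

lemma t_stp_add_right:
  assumes "n > 0" "p > 0" "s > 0"
  shows "t_stp m n p q s A (cubic_add p q s X Y) =
    cubic_add m q s (t_stp m n p q s A X) (t_stp m n p q s A Y)"
  by (rule cubic_eqI[OF t_stp_closed cubic_add_closed])
    (simp add: t_stp_entry[OF assms] cubic_add_entry t_stp_index distrib_left sum.distrib)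

text \<open>The expansions of \<open>n\<close>, \<open>p\<close> between \<open>A\<close> and
  \<open>B\<close> and of \<open>r\<close>, \<open>h\<close> between \<open>B\<close> and
  \<open>X\<close> act independently on the rows and the columns of \<open>B\<close>, so both sides
  are the same fourfold sum. With free sizes this covers the ring and the module law.\<close>

lemma t_stp_assoc:
  assumes pos: "n > 0" "p > 0" "s > 0" "r > 0" "h > 0"
  shows "t_stp m r h q s (t_stp m n p r s A B) X = t_stp m n p q s A (t_stp p r h q s B X)"
proof (rule cubic_eqI[OF t_stp_closed t_stp_closed])
  fix i j k assume idx: "(i, j, k) \<in> cubic_index m q s"
  define L where "L = lcm n p"
  define u where "u = L div n"
  define v where "v = L div p"
  define L' where "L' = lcm r h"
  define u' where "u' = L' div r"
  define v' where "v' = L' div h"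
  note defs = L_def u_def v_def L'_def u'_def v'_def
  \<comment> \<open>The summand as the right-hand side produces it: \<open>e\<close> is the slice of
    \<open>A\<close>'s partner, the inner product, and \<open>c\<close> that of
    \<open>X\<close>.\<close>
  define F where "F e c l x = A (i, l div u, cyclic_diff s k e) *
    (B (l div v, x div u', cyclic_diff s e c) * X (x div v', j, c))" for e c l x
  have "t_stp m r h q s (t_stp m n p r s A B) X (i, j, k) =
      (\<Sum>c<s. \<Sum>x<L'. (\<Sum>d<s. \<Sum>l<L. A (i, l div u, cyclic_diff s (cyclic_diff s k c) d) *
        B (l div v, x div u', d)) * X (x div v', j, c))"
    using pos idx by (simp add: t_stp_entry t_stp_index defs)
  also have "\<dots> = (\<Sum>c<s. \<Sum>x<L'. \<Sum>e<s. \<Sum>l<L. F e c l x)"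
  proof (intro sum.cong refl)
    fix c x
    have "(\<Sum>d<s. \<Sum>l<L. A (i, l div u, cyclic_diff s (cyclic_diff s k c) d) *
        B (l div v, x div u', d)) =
      (\<Sum>e<s. \<Sum>l<L. A (i, l div u, cyclic_diff s k e) * B (l div v, x div u', cyclic_diff s e c))"
      \<comment> \<open>Substituting \<open>d = e - c\<close> modulo \<open>s\<close> turns the
        index \<open>(k - c) - d\<close> into \<open>k - e\<close>.\<close>
      by (subst sum_cyclic_diff[OF pos(3), of _ c]) (simp add: cyclic_diff_diff[OF pos(3)])
    then show "(\<Sum>d<s. \<Sum>l<L. A (i, l div u, cyclic_diff s (cyclic_diff s k c) d) *
        B (l div v, x div u', d)) * X (x div v', j, c) = (\<Sum>e<s. \<Sum>l<L. F e c l x)"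
      by (simp add: F_def sum_distrib_right mult.assoc)
  qed
  also have "\<dots> = (\<Sum>c<s. \<Sum>e<s. \<Sum>l<L. \<Sum>x<L'. F e c l x)"
    \<comment> \<open>Naming the ranges selects the pairs to exchange: \<open>x\<close> moves inward
      past \<open>e\<close>, then past \<open>l\<close>.\<close>
    by (subst sum.swap[of _ "{..<s}" "{..<L'}"], subst sum.swap[of _ "{..<L}" "{..<L'}"]) (rule refl)
  also have "\<dots> = (\<Sum>e<s. \<Sum>l<L. \<Sum>c<s. \<Sum>x<L'. F e c l x)"
    by (subst sum.swap, subst (2) sum.swap) (rule refl)
  also have "\<dots> = t_stp m n p q s A (t_stp p r h q s B X) (i, j, k)"
    using pos idx by (simp add: t_stp_entry t_stp_index defs F_def sum_distrib_left)
  finally show "t_stp m r h q s (t_stp m n p r s A B) X (i, j, k) =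
      t_stp m n p q s A (t_stp p r h q s B X) (i, j, k)" .
qed

section \<open>The group, the ring and the module\<close>

lemma cubic_group_simps:
  "carrier (cubic_group m n s) = cubic_carrier m n s"
  "zero (cubic_group m n s) = cubic_zero m n s"
  "add (cubic_group m n s) = cubic_add m n s"
  by (simp_all add: cubic_group_def)

lemma t_stp_ring_simps:
  "carrier (t_stp_ring n p s) = cubic_carrier n p s"
  "zero (t_stp_ring n p s) = cubic_zero n p s"
  "add (t_stp_ring n p s) = cubic_add n p s"
  "mult (t_stp_ring n p s) = t_stp n p n p s"
  by (simp_all add: t_stp_ring_def cubic_group_def)

lemma t_stp_module_simps:
  "carrier (t_stp_module n p q s) = cubic_carrier n q s"
  "zero (t_stp_module n p q s) = cubic_zero n q s"
  "add (t_stp_module n p q s) = cubic_add n q s"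
  "smult (t_stp_module n p q s) = t_stp n p n q s"
  by (simp_all add: t_stp_module_def cubic_group_def ring.defs module.defs)

text \<open>Stated for any record with these fields, so that it serves all three structures.\<close>

lemma abelian_group_cubic:
  fixes G (structure)
  assumes "carrier G = cubic_carrier m n s" "zero G = cubic_zero m n s"
    "add G = cubic_add m n s"
  shows "abelian_group G"
proof (rule abelian_groupI)
  fix x assume x: "x \<in> carrier G"
  show "\<exists>y\<in>carrier G. y \<oplus> x = \<zero>"
    \<comment> \<open>The restriction keeps the entrywise negative extensional, as the carrier
      requires.\<close>
    by (rule bexI[of _ "restrict (\<lambda>a. - x a) (cubic_index m n s)"])
      (auto simp: assms cubic_carrier_def cubic_add_def cubic_zero_def)
  show "\<zero> \<oplus> x = x"
    using x by (auto simp: assms cubic_carrier_def cubic_add_def cubic_zero_def fun_eq_iff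
        PiE_def extensional_def)
qed (auto simp: assms cubic_carrier_def cubic_add_def cubic_zero_def fun_eq_iff)

theorem corollary3:
  fixes n p q s :: nat
  assumes "n > 0" and "p > 0" and "q > 0" and "s > 0"
  shows "abelian_group (cubic_group n q s) \<and>
         nonunital_ring (t_stp_ring n p s) \<and>
         left_module (t_stp_ring n p s) (t_stp_module n p q s)"
proof (intro conjI)
  \<comment> \<open>These facts hold for all positive inner sizes, so they serve the ring, where the
    right factor has \<open>p\<close> columns, and the module, where it has
    \<open>q\<close>.\<close>
  note bilinear = t_stp_closed t_stp_add_left t_stp_add_right
  show "abelian_group (cubic_group n q s)"
    by (rule abelian_group_cubic) (rule cubic_group_simps)+
  have "abelian_group (t_stp_ring n p s)"
    by (rule abelian_group_cubic) (rule t_stp_ring_simps)+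
  then show ring: "nonunital_ring (t_stp_ring n p s)"
    by (rule nonunital_ring.intro, unfold_locales)
      (use assms in \<open>simp_all add: t_stp_ring_simps bilinear t_stp_assoc\<close>)
  have "abelian_group (t_stp_module n p q s)"
    by (rule abelian_group_cubic) (rule t_stp_module_simps)+
  with ring show "left_module (t_stp_ring n p s) (t_stp_module n p q s)"
    by (rule left_module.intro, unfold_locales)
      (use assms in \<open>simp_all add: t_stp_ring_simps t_stp_module_simps bilinear t_stp_assoc\<close>)
qed

end
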